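(* Let $\mu\in(0,1/2]$ and let $\beta_1,\beta_2>0$ satisfy, with $\delta_i=\beta_i^{1/3}$ ($i=1,2$), $$\delta_1+1>\delta_2,\qquad \delta_2+1>\delta_1,\qquad \delta_1+\delta_2>1,\qquad (\beta_1-1)(\beta_2-1)<1 .$$ Let $(x_L,\pm y_L)$, $y_L>0$, be the two triangular equilibrium solutions of the planar circular restricted charged three-body problem with parameters $\mu,\beta_1,\beta_2$. Then: \begin{itemize} \item if $\beta_2^{1/3}>\sqrt{1+\beta_1^{2/3}}$, the equilibrium solutions are to the left of body $1$, i.e. $x_L<-\mu$; \item if $\beta_2^{1/3}=\sqrt{1+\beta_1^{2/3}}$, they are above or below body $1$, i.e. $x_L=-\mu$; \item if $\beta_1^{1/3}<\sqrt{1+\beta_2^{2/3}}$ and $\beta_2^{1/3}<\sqrt{1+\beta_1^{2/3}}$, they are between bodies $1$ and $2$, i.e. $-\mu<x_L<1-\mu$; \item if $\beta_1^{1/3}=\sqrt{1+\beta_2^{2/3}}$, they are above or below body $2$, i.e. $x_L=1-\mu$; \item if $\beta_1^{1/3}>\sqrt{1+\beta_2^{2/3}}$, they are to the right of body $2$, i.e. $x_L>1-\mu$. \end{itemize}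
   Context: The planar circular restricted charged three-body problem with parameters $\mu\in(0,1/2]$ and $\beta_1,\beta_2\in\mathbb{R}$ subject to $(\beta_1-1)(\beta_2-1)<1$ is the system $$\ddot x-2\dot y-x=V_x,\qquad \ddot y+2\dot x-y=V_y,\qquad V=\frac{\beta_1(1-\mu)}{\rho_1}+\frac{\beta_2\mu}{\rho_2},$$ with $\rho_1=\sqrt{(x+\mu)^2+y^2}$ and $\rho_2=\sqrt{(x-1+\mu)^2+y^2}$, considered at points with $\rho_1,\rho_2\neq0$. Body $1$ is at $(-\mu,0)$ and body $2$ at $(1-\mu,0)$. An equilibrium solution is a point $(x,y)$ (with $\rho_1,\rho_2\ne 0$) such that $V_x+x=0$ and $V_y+y=0$; it is called triangular if $y\neq0$. Under the stated inequalities there are exactly two triangular equilibrium solutions, $(x_L,\pm y_L)$, with $$x_L=-\mu+\tfrac12\left(\beta_1^{2/3}-\beta_2^{2/3}+1\right),\qquad y_L=\tfrac12\sqrt{2\left(\beta_1^{2/3}+\beta_2^{2/3}\right)-\left(\beta_1^{2/3}-\beta_2^{2/3}\right)^2-1}.$$ *)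

theory Defs
  imports "HOL-Analysis.Analysis"
begin

definition rho1 :: "real \<Rightarrow> real \<Rightarrow> real \<Rightarrow> real" where
  "rho1 \<mu> x y = sqrt ((x + \<mu>)\<^sup>2 + y\<^sup>2)"

definition rho2 :: "real \<Rightarrow> real \<Rightarrow> real \<Rightarrow> real" where
  "rho2 \<mu> x y = sqrt ((x - 1 + \<mu>)\<^sup>2 + y\<^sup>2)"

definition potential :: "real \<Rightarrow> real \<Rightarrow> real \<Rightarrow> real \<Rightarrow> real \<Rightarrow> real" where
  "potential \<mu> \<beta>\<^sub>1 \<beta>\<^sub>2 x y = \<beta>\<^sub>1 * (1 - \<mu>) / rho1 \<mu> x y + \<beta>\<^sub>2 * \<mu> / rho2 \<mu> x y"

text \<open>
  In the planar circular restricted charged three-body problem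
  x'' - 2 y' - x = V_x, y'' + 2 x' - y = V_y (with V the potential above), an equilibrium is a
  point off the two bodies where V_x + x = 0 and V_y + y = 0. Away from the bodies V is
  differentiable, so the total function \<^const>\<open>deriv\<close> gives the genuine partial derivatives.
\<close>

definition equilibrium :: "real \<Rightarrow> real \<Rightarrow> real \<Rightarrow> real \<Rightarrow> real \<Rightarrow> bool" where
  "equilibrium \<mu> \<beta>\<^sub>1 \<beta>\<^sub>2 x y \<longleftrightarrow>
     rho1 \<mu> x y \<noteq> 0 \<and> rho2 \<mu> x y \<noteq> 0 \<and>
     deriv (\<lambda>s. potential \<mu> \<beta>\<^sub>1 \<beta>\<^sub>2 s y) x + x = 0 \<and>
     deriv (\<lambda>t. potential \<mu> \<beta>\<^sub>1 \<beta>\<^sub>2 x t) y + y = 0"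

definition triangular_equilibrium :: "real \<Rightarrow> real \<Rightarrow> real \<Rightarrow> real \<Rightarrow> real \<Rightarrow> bool" where
  "triangular_equilibrium \<mu> \<beta>\<^sub>1 \<beta>\<^sub>2 x y \<longleftrightarrow> equilibrium \<mu> \<beta>\<^sub>1 \<beta>\<^sub>2 x y \<and> y \<noteq> 0"

end

theory Submission
  imports Defs
begin

text \<open>
  Write \<open>A = \<beta>\<^sub>1 (1 - \<mu>) / \<rho>\<^sub>1\<^sup>3\<close> and \<open>B = \<beta>\<^sub>2 \<mu> / \<rho>\<^sub>2\<^sup>3\<close>. The two equilibrium equations are
  \<open>x = A (x + \<mu>) + B (x - 1 + \<mu>)\<close> and \<open>y = (A + B) y\<close>. Off the axis the second one says
  \<open>A + B = 1\<close>; then \<open>x\<close> cancels from the first, which leaves \<open>B = \<mu>\<close> and hence \<open>A = 1 - \<mu>\<close>.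
  So the triangular equilibria are exactly the points off the axis with \<open>\<rho>\<^sub>1\<^sup>3 = \<beta>\<^sub>1\<close> and
  \<open>\<rho>\<^sub>2\<^sup>3 = \<beta>\<^sub>2\<close> (lemma \<open>triangular_equilibrium_iff_cubes\<close>): the intersection of the circles of
  radii \<open>\<delta>\<^sub>1 = \<beta>\<^sub>1\<^sup>1\<^sup>/\<^sup>3\<close> and \<open>\<delta>\<^sub>2 = \<beta>\<^sub>2\<^sup>1\<^sup>/\<^sup>3\<close> around the two bodies, which are at distance \<open>1\<close>.

  Subtracting the equations of the circles gives \<open>x\<^sub>L + \<mu> = (\<delta>\<^sub>1\<^sup>2 - \<delta>\<^sub>2\<^sup>2 + 1) / 2\<close>, and the strict
  triangle inequalities between \<open>\<delta>\<^sub>1\<close>, \<open>\<delta>\<^sub>2\<close>, \<open>1\<close> make \<open>y\<^sub>L\<^sup>2\<close> positive by Heron's formula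
  (lemma \<open>circles_at_unit_distance_meet\<close>). The position of \<open>x\<^sub>L\<close> relative to body 1 is thus the
  sign of \<open>1 + \<delta>\<^sub>1\<^sup>2 - \<delta>\<^sub>2\<^sup>2\<close>, and relative to body 2 the sign of \<open>\<delta>\<^sub>1\<^sup>2 - \<delta>\<^sub>2\<^sup>2 - 1\<close>: these compare
  the angles of the triangle at the bodies with a right angle.
\<close>

text \<open>
  Differentiating through the squared distance \<open>Q\<close> lets one formula serve for both bodies and
  for both coordinates.
\<close>

lemma has_real_derivative_inverse_distance:
  fixes Q :: "real \<Rightarrow> real"
  assumes "(Q has_real_derivative 2 * d) (at s)" and "Q s > 0"
  shows "((\<lambda>s. c / sqrt (Q s)) has_real_derivative - (c / sqrt (Q s) ^ 3 * d)) (at s)"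
proof -
  have "((\<lambda>s. sqrt (Q s)) has_real_derivative inverse (sqrt (Q s)) / 2 * (2 * d)) (at s)"
    using assms by (intro DERIV_chain2[OF DERIV_real_sqrt])
  from DERIV_divide[OF DERIV_const[of c] this] show ?thesis
    using assms(2) by (simp add: field_simps power3_eq_cube)
qed

lemma deriv_potential_x:
  assumes "rho1 \<mu> x y \<noteq> 0" and "rho2 \<mu> x y \<noteq> 0"
  shows "deriv (\<lambda>s. potential \<mu> \<beta>\<^sub>1 \<beta>\<^sub>2 s y) x =
    - (\<beta>\<^sub>1 * (1 - \<mu>) / rho1 \<mu> x y ^ 3 * (x + \<mu>) + \<beta>\<^sub>2 * \<mu> / rho2 \<mu> x y ^ 3 * (x - 1 + \<mu>))"
proof -
  have pos: "(x + \<mu>)\<^sup>2 + y\<^sup>2 > 0" "(x - 1 + \<mu>)\<^sup>2 + y\<^sup>2 > 0"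
    using assms by (auto simp: rho1_def rho2_def sum_power2_gt_zero_iff)
  have "((\<lambda>s. (s + \<mu>)\<^sup>2 + y\<^sup>2) has_real_derivative 2 * (x + \<mu>)) (at x)"
    and "((\<lambda>s. (s - 1 + \<mu>)\<^sup>2 + y\<^sup>2) has_real_derivative 2 * (x - 1 + \<mu>)) (at x)"
    by (auto intro!: derivative_eq_intros)
  from DERIV_add[OF this(1)[THEN has_real_derivative_inverse_distance, OF pos(1)]
      this(2)[THEN has_real_derivative_inverse_distance, OF pos(2)]]
  show ?thesis
    unfolding potential_def rho1_def rho2_def by (intro DERIV_imp_deriv) simp
qed

lemma deriv_potential_y:
  assumes "rho1 \<mu> x y \<noteq> 0" and "rho2 \<mu> x y \<noteq> 0"
  shows "deriv (\<lambda>t. potential \<mu> \<beta>\<^sub>1 \<beta>\<^sub>2 x t) y =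
    - (\<beta>\<^sub>1 * (1 - \<mu>) / rho1 \<mu> x y ^ 3 * y + \<beta>\<^sub>2 * \<mu> / rho2 \<mu> x y ^ 3 * y)"
proof -
  have pos: "(x + \<mu>)\<^sup>2 + y\<^sup>2 > 0" "(x - 1 + \<mu>)\<^sup>2 + y\<^sup>2 > 0"
    using assms by (auto simp: rho1_def rho2_def sum_power2_gt_zero_iff)
  have "((\<lambda>t. (x + \<mu>)\<^sup>2 + t\<^sup>2) has_real_derivative 2 * y) (at y)"
    and "((\<lambda>t. (x - 1 + \<mu>)\<^sup>2 + t\<^sup>2) has_real_derivative 2 * y) (at y)"
    by (auto intro!: derivative_eq_intros)
  from DERIV_add[OF this(1)[THEN has_real_derivative_inverse_distance, OF pos(1)]
      this(2)[THEN has_real_derivative_inverse_distance, OF pos(2)]]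
  show ?thesis
    unfolding potential_def rho1_def rho2_def by (intro DERIV_imp_deriv) simp
qed

text \<open>
  The two force balances determine the weights \<open>A\<close>, \<open>B\<close> of the two attractions: off the axis, they
  make the origin, the centre of mass of masses \<open>1 - \<mu>\<close> and \<open>\<mu>\<close> at the bodies, the barycentre
  of the bodies with weights \<open>A\<close>, \<open>B\<close>.
\<close>

lemma triangular_equilibrium_iff_cubes:
  assumes "0 < \<mu>" and "\<mu> < 1"
  shows "triangular_equilibrium \<mu> \<beta>\<^sub>1 \<beta>\<^sub>2 x y \<longleftrightarrow>
    y \<noteq> 0 \<and> rho1 \<mu> x y ^ 3 = \<beta>\<^sub>1 \<and> rho2 \<mu> x y ^ 3 = \<beta>\<^sub>2"
proof (cases "y = 0")
  case True
  then show ?thesis by (simp add: triangular_equilibrium_def)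
next
  case False
  define A where "A = \<beta>\<^sub>1 * (1 - \<mu>) / rho1 \<mu> x y ^ 3"
  define B where "B = \<beta>\<^sub>2 * \<mu> / rho2 \<mu> x y ^ 3"
  have r: "rho1 \<mu> x y \<noteq> 0" "rho2 \<mu> x y \<noteq> 0"
    using False by (auto simp: rho1_def rho2_def sum_power2_eq_zero_iff)
  have "triangular_equilibrium \<mu> \<beta>\<^sub>1 \<beta>\<^sub>2 x y \<longleftrightarrow>
      x = A * (x + \<mu>) + B * (x - 1 + \<mu>) \<and> y = A * y + B * y"
    using r False
    by (auto simp: triangular_equilibrium_def equilibrium_def deriv_potential_x deriv_potential_y
        A_def B_def)
  also have "y = A * y + B * y \<longleftrightarrow> A = 1 - B"
  proof -
    have "y = A * y + B * y \<longleftrightarrow> y * (A - (1 - B)) = 0" by (auto simp: algebra_simps)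
    then show ?thesis using False by simp
  qed
  also have "x = A * (x + \<mu>) + B * (x - 1 + \<mu>) \<and> A = 1 - B \<longleftrightarrow> A = 1 - \<mu> \<and> B = \<mu>"
  proof -
    have "A * (x + \<mu>) + B * (x - 1 + \<mu>) = x + \<mu> - B" if "A = 1 - B"
      by (simp add: that algebra_simps)
    then show ?thesis by auto
  qed
  also have "A = 1 - \<mu> \<longleftrightarrow> rho1 \<mu> x y ^ 3 = \<beta>\<^sub>1"
    using r assms by (auto simp: A_def divide_eq_eq)
  also have "B = \<mu> \<longleftrightarrow> rho2 \<mu> x y ^ 3 = \<beta>\<^sub>2"
    using r assms by (auto simp: B_def divide_eq_eq)
  finally show ?thesis using False by simp
qed

lemma sqrt_cube_eq_iff:
  fixes \<beta> :: real
  assumes "0 \<le> Q" and "0 < \<beta>"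
  shows "sqrt Q ^ 3 = \<beta> \<longleftrightarrow> Q = (\<beta> powr (1/3))\<^sup>2"
proof -
  have "(\<beta> powr (1/3)) ^ 3 = \<beta>"
    using assms by (simp add: powr_power)
  then have "sqrt Q ^ 3 = \<beta> \<longleftrightarrow> sqrt Q ^ 3 = (\<beta> powr (1/3)) ^ 3" by simp
  also have "\<dots> \<longleftrightarrow> sqrt Q = \<beta> powr (1/3)"
    using assms by (simp add: power_eq_iff_eq_base)
  also have "\<dots> \<longleftrightarrow> Q = (\<beta> powr (1/3))\<^sup>2"
    using assms by (metis powr_ge_zero real_sqrt_pow2 real_sqrt_unique)
  finally show ?thesis .
qed

text \<open>
  The difference of the equations of the two circles is linear in \<open>u\<close>; what remains for \<open>v\<close>
  is a square, positive because \<open>4 v\<^sup>2\<close> is Heron's product for a triangle of sides \<open>a\<close>, \<open>b\<close>, \<open>1\<close>.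
\<close>

lemma circles_at_unit_distance_meet:
  fixes a b :: real
  assumes "a + 1 > b" and "b + 1 > a" and "a + b > 1"
  obtains h where "h > 0"
    and "\<And>u v. u\<^sup>2 + v\<^sup>2 = a\<^sup>2 \<and> (u - 1)\<^sup>2 + v\<^sup>2 = b\<^sup>2 \<longleftrightarrow>
      u = (a\<^sup>2 - b\<^sup>2 + 1) / 2 \<and> (v = h \<or> v = - h)"
proof -
  define p where "p = (a\<^sup>2 - b\<^sup>2 + 1) / 2"
  have "4 * (a\<^sup>2 - p\<^sup>2) = (a + b + 1) * (a + b - 1) * ((b + 1 - a) * (a + 1 - b))"
    by (simp add: p_def power2_eq_square field_simps)
  also have "\<dots> > 0" using assms by (intro mult_pos_pos) auto
  finally have pos: "a\<^sup>2 - p\<^sup>2 > 0" by simp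
  have "u\<^sup>2 + v\<^sup>2 = a\<^sup>2 \<and> (u - 1)\<^sup>2 + v\<^sup>2 = b\<^sup>2 \<longleftrightarrow>
      u = p \<and> (v = sqrt (a\<^sup>2 - p\<^sup>2) \<or> v = - sqrt (a\<^sup>2 - p\<^sup>2))" for u v
  proof -
    have "u\<^sup>2 + v\<^sup>2 = a\<^sup>2 \<and> (u - 1)\<^sup>2 + v\<^sup>2 = b\<^sup>2 \<longleftrightarrow> u\<^sup>2 + v\<^sup>2 = a\<^sup>2 \<and> u = p"
      by (auto simp: p_def power2_diff)
    also have "\<dots> \<longleftrightarrow> u = p \<and> v\<^sup>2 = (sqrt (a\<^sup>2 - p\<^sup>2))\<^sup>2"
      using pos by auto
    finally show ?thesis by (simp only: power2_eq_iff)
  qed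
  then show ?thesis
    using that[of "sqrt (a\<^sup>2 - p\<^sup>2)"] pos unfolding p_def by simp
qed

theorem proposition4p1:
  fixes \<mu> \<beta>\<^sub>1 \<beta>\<^sub>2 :: real
  assumes "0 < \<mu>" and "\<mu> \<le> 1 / 2"
    and "0 < \<beta>\<^sub>1" and "0 < \<beta>\<^sub>2"
    and "\<beta>\<^sub>1 powr (1/3) + 1 > \<beta>\<^sub>2 powr (1/3)"
    and "\<beta>\<^sub>2 powr (1/3) + 1 > \<beta>\<^sub>1 powr (1/3)"
    and "\<beta>\<^sub>1 powr (1/3) + \<beta>\<^sub>2 powr (1/3) > 1"
    and "(\<beta>\<^sub>1 - 1) * (\<beta>\<^sub>2 - 1) < 1"
  shows "\<exists>x\<^sub>L y\<^sub>L. y\<^sub>L > 0 \<and>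
    {(x, y). triangular_equilibrium \<mu> \<beta>\<^sub>1 \<beta>\<^sub>2 x y} = {(x\<^sub>L, y\<^sub>L), (x\<^sub>L, - y\<^sub>L)} \<and>
    (\<beta>\<^sub>2 powr (1/3) > sqrt (1 + \<beta>\<^sub>1 powr (2/3)) \<longrightarrow> x\<^sub>L < - \<mu>) \<and>
    (\<beta>\<^sub>2 powr (1/3) = sqrt (1 + \<beta>\<^sub>1 powr (2/3)) \<longrightarrow> x\<^sub>L = - \<mu>) \<and>
    (\<beta>\<^sub>1 powr (1/3) < sqrt (1 + \<beta>\<^sub>2 powr (2/3)) \<and> \<beta>\<^sub>2 powr (1/3) < sqrt (1 + \<beta>\<^sub>1 powr (2/3))
       \<longrightarrow> - \<mu> < x\<^sub>L \<and> x\<^sub>L < 1 - \<mu>) \<and>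
    (\<beta>\<^sub>1 powr (1/3) = sqrt (1 + \<beta>\<^sub>2 powr (2/3)) \<longrightarrow> x\<^sub>L = 1 - \<mu>) \<and>
    (\<beta>\<^sub>1 powr (1/3) > sqrt (1 + \<beta>\<^sub>2 powr (2/3)) \<longrightarrow> x\<^sub>L > 1 - \<mu>)"
proof -
  define a where "a = \<beta>\<^sub>1 powr (1/3)"
  define b where "b = \<beta>\<^sub>2 powr (1/3)"
  define x\<^sub>L where "x\<^sub>L = - \<mu> + (a\<^sup>2 - b\<^sup>2 + 1) / 2"
  have ab: "a > 0" "b > 0" using assms by (simp_all add: a_def b_def)
  have sq: "\<beta>\<^sub>1 powr (2/3) = a\<^sup>2" "\<beta>\<^sub>2 powr (2/3) = b\<^sup>2"
    using assms by (simp_all add: a_def b_def powr_power)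
  obtain y\<^sub>L where yL: "y\<^sub>L > 0"
    and circles: "\<And>u v. u\<^sup>2 + v\<^sup>2 = a\<^sup>2 \<and> (u - 1)\<^sup>2 + v\<^sup>2 = b\<^sup>2 \<longleftrightarrow>
      u = (a\<^sup>2 - b\<^sup>2 + 1) / 2 \<and> (v = y\<^sub>L \<or> v = - y\<^sub>L)"
    by (rule circles_at_unit_distance_meet[OF assms(5-7)[folded a_def b_def]]) (rule that)
  have "triangular_equilibrium \<mu> \<beta>\<^sub>1 \<beta>\<^sub>2 x y \<longleftrightarrow> x = x\<^sub>L \<and> (y = y\<^sub>L \<or> y = - y\<^sub>L)" for x y
  proof -
    have "triangular_equilibrium \<mu> \<beta>\<^sub>1 \<beta>\<^sub>2 x y \<longleftrightarrow>
        y \<noteq> 0 \<and> (x + \<mu>)\<^sup>2 + y\<^sup>2 = a\<^sup>2 \<and> (x + \<mu> - 1)\<^sup>2 + y\<^sup>2 = b\<^sup>2"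
      using assms
      by (simp add: triangular_equilibrium_iff_cubes rho1_def rho2_def sqrt_cube_eq_iff
          a_def b_def algebra_simps)
    also have "\<dots> \<longleftrightarrow> x = x\<^sub>L \<and> (y = y\<^sub>L \<or> y = - y\<^sub>L)"
      unfolding circles x\<^sub>L_def using yL by (auto simp: field_simps)
    finally show ?thesis .
  qed
  then have set: "{(x, y). triangular_equilibrium \<mu> \<beta>\<^sub>1 \<beta>\<^sub>2 x y} = {(x\<^sub>L, y\<^sub>L), (x\<^sub>L, - y\<^sub>L)}"
    by auto
  \<comment> \<open>Squaring turns each comparison with a hypotenuse into the sign of an angle's cosine.\<close>
  have less: "s < sqrt (1 + t\<^sup>2) \<longleftrightarrow> s\<^sup>2 < 1 + t\<^sup>2"
    and greater: "sqrt (1 + t\<^sup>2) < s \<longleftrightarrow> 1 + t\<^sup>2 < s\<^sup>2" if "s > 0" for s t :: real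
    using that real_sqrt_less_iff[of "s\<^sup>2" "1 + t\<^sup>2"] real_sqrt_less_iff[of "1 + t\<^sup>2" "s\<^sup>2"]
    by simp_all
  have eq: "s = sqrt (1 + t\<^sup>2) \<longleftrightarrow> s\<^sup>2 = 1 + t\<^sup>2" if "s > 0" for s t :: real
    using less[OF that, of t] greater[OF that, of t] by linarith
  show ?thesis
    unfolding a_def[symmetric] b_def[symmetric] sq
    using yL set by (intro exI[of _ x\<^sub>L] exI[of _ y\<^sub>L])
      (simp add: less[OF ab(1)] less[OF ab(2)] greater[OF ab(1)] greater[OF ab(2)]
        eq[OF ab(1)] eq[OF ab(2)] x\<^sub>L_def)
qed

end
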